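(* (i) Let $n\ge 1$ be an integer, let $m$ be an integer with $\gcd(n,m)=1$, and let $q=e^{2\pi m i/n}$. If $5\mid n$, then $$\sum_{k=0}^{n-1}(-1)^k q^{-\binom{k}{2}}C_k^q=\frac12\left(\sqrt{5}\left(\frac{m}{5}\right)-3\right).$$ (ii) Moreover, for any integer $a>0$ and any prime $p$, $$\sum_{k=0}^{p^a-1}(-1)^kC_k\equiv\frac12\left(5\left(\frac{p^a}{5}\right)-3\right)\pmod p.$$
   Context: The Gaussian $q$-binomial coefficient $\binom{n}{k}_q$ is the polynomial in $q$ given by $\binom{n}{k}_q=\dfrac{(q;q)_n}{(q;q)_k(q;q)_{n-k}}$ if $0\le k\le n$ and $\binom{n}{k}_q=0$ otherwise, where $(z;q)_n=\prod_{j=0}^{n-1}(1-zq^j)$. The $q$-Catalan number is the polynomial $C_n^q=\dfrac{1}{[n+1]_q}\binom{2n}{n}_q=\binom{2n}{n}_q-q\binom{2n}{n+1}_q$, where $[n+1]_q=\dfrac{1-q^{n+1}}{1-q}$; at a root of unity it denotes the value of this polynomial. In the exponent, $\binom{k}{2}=k(k-1)/2$ is the ordinary binomial coefficient. $C_n=\frac{1}{n+1}\binom{2n}{n}$ is the ordinary Catalan number. $\left(\frac{\cdot}{5}\right)$ is the Legendre symbol modulo $5$ (equal to $0$ for multiples of $5$). The congruence modulo $p$ is between rational numbers with denominator prime to $p$ (the right-hand side is an integer when $p\ne 5$, and equals $-3/2$ when $p=5$). *)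

theory Defs
  imports Complex_Main
    "HOL-Computational_Algebra.Computational_Algebra"
    "HOL-Number_Theory.Number_Theory"
begin

definition qpochhammer :: "'a::comm_ring_1 \<Rightarrow> 'a \<Rightarrow> nat \<Rightarrow> 'a" where
  "qpochhammer z q n = (\<Prod>j<n. 1 - z * q ^ j)"

abbreviation qvar :: "int poly" where
  "qvar \<equiv> [:0, 1:]"

definition qnumber :: "nat \<Rightarrow> int poly" where
  "qnumber n = (1 - qvar ^ n) div (1 - qvar)"

definition qbinomial :: "nat \<Rightarrow> nat \<Rightarrow> int poly" where
  "qbinomial n k =
     (if k \<le> n
      then qpochhammer qvar qvar n div (qpochhammer qvar qvar k * qpochhammer qvar qvar (n - k))
      else 0)"

definition qcatalan :: "nat \<Rightarrow> int poly" where
  "qcatalan n = qbinomial (2 * n) n div qnumber (n + 1)"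

definition catalan :: "nat \<Rightarrow> nat" where
  "catalan n = ((2 * n) choose n) div (n + 1)"

text \<open>Every \<open>div\<close> above is exact; the following lemmas record this.\<close>

lemma one_minus_qvar_power_nonzero: "n > 0 \<Longrightarrow> 1 - qvar ^ n \<noteq> 0"
proof
  assume "n > 0" and "1 - qvar ^ n = 0"
  then have "poly (1 - qvar ^ n) 0 = 0" by simp
  with \<open>n > 0\<close> show False by (simp add: poly_power power_0_left)
qed

lemma qpochhammer_Suc:
  "qpochhammer qvar qvar (Suc n) = qpochhammer qvar qvar n * (1 - qvar ^ Suc n)"
  by (simp add: qpochhammer_def)

lemma qpochhammer_nonzero: "qpochhammer qvar qvar n \<noteq> 0"
proof (induction n)
  case 0
  show ?case by (simp add: qpochhammer_def)
next
  case (Suc n)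
  then show ?case
    unfolding qpochhammer_Suc using one_minus_qvar_power_nonzero[of "Suc n"] by auto
qed

lemma qnumber_exact: "qnumber n * (1 - qvar) = 1 - qvar ^ n"
proof -
  have "1 - qvar ^ n = (1 - qvar) * (\<Sum>i<n. qvar ^ i)"
    by (rule one_diff_power_eq)
  then have "(1 - qvar) dvd (1 - qvar ^ n)" by (rule dvdI)
  then show ?thesis unfolding qnumber_def by (rule dvd_div_mult_self)
qed

lemma qpochhammer_dvd:
  "k \<le> n \<Longrightarrow>
     qpochhammer qvar qvar k * qpochhammer qvar qvar (n - k) dvd qpochhammer qvar qvar n"
proof (induction n arbitrary: k)
  case 0
  then show ?case by (simp add: qpochhammer_def)
next
  case (Suc n)
  let ?P = "qpochhammer qvar qvar"
  show ?case
  proof (cases "k = 0 \<or> k = Suc n")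
    case True
    then show ?thesis by (auto simp: qpochhammer_def)
  next
    case False
    with Suc.prems obtain j where k: "k = Suc j" and j: "j < n"
      by (metis Suc_leI Suc_less_eq le_neq_implies_less not0_implies_Suc)
    define l where "l = n - Suc j"
    have nk: "Suc n - k = Suc l" and nj: "n - j = Suc l" and n: "n = Suc j + l"
      using k j by (auto simp: l_def)
    have "?P j * ?P (Suc l) dvd ?P n"
      using Suc.IH[of j] j nj by simp
    then have "(1 - qvar ^ k) * (?P j * ?P (Suc l)) dvd (1 - qvar ^ k) * ?P n"
      by (rule mult_dvd_mono[OF dvd_refl])
    moreover have "(1 - qvar ^ k) * (?P j * ?P (Suc l)) = ?P k * ?P (Suc n - k)"
      unfolding nk unfolding k qpochhammer_Suc[of j] by (simp only: mult_ac)
    ultimately have A: "?P k * ?P (Suc n - k) dvd (1 - qvar ^ k) * ?P n"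
      by simp
    have "?P k * ?P l dvd ?P n"
      using Suc.IH[of k] k j l_def by simp
    then have "(1 - qvar ^ Suc l) * (?P k * ?P l) dvd (qvar ^ k * (1 - qvar ^ Suc l)) * ?P n"
      by (rule mult_dvd_mono[OF dvd_triv_right])
    moreover have "(1 - qvar ^ Suc l) * (?P k * ?P l) = ?P k * ?P (Suc n - k)"
      unfolding nk qpochhammer_Suc[of l] by (simp only: mult_ac)
    ultimately have B: "?P k * ?P (Suc n - k) dvd (qvar ^ k * (1 - qvar ^ Suc l)) * ?P n"
      by metis
    have "Suc n = k + Suc l" using n k by simp
    then have pw: "qvar ^ Suc n = qvar ^ k * qvar ^ Suc l"
      by (simp only: power_add)
    have "x * (1 - a * b) = (1 - a) * x + (a * (1 - b)) * x" for a b x :: "int poly"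
      by (simp add: algebra_simps)
    then have "?P (Suc n) = (1 - qvar ^ k) * ?P n + (qvar ^ k * (1 - qvar ^ Suc l)) * ?P n"
      unfolding qpochhammer_Suc[of n] pw .
    with A B show ?thesis by (metis dvd_add)
  qed
qed

lemma qbinomial_exact:
  "k \<le> n \<Longrightarrow>
     qbinomial n k * (qpochhammer qvar qvar k * qpochhammer qvar qvar (n - k)) =
     qpochhammer qvar qvar n"
  by (simp add: qbinomial_def qpochhammer_dvd)

lemma qcatalan_aux:
  "qnumber (n + 1) * (qbinomial (2 * n) n - qvar * qbinomial (2 * n) (n + 1)) =
   qbinomial (2 * n) n"
proof (cases n)
  case 0
  have "qnumber 1 * (1 - qvar) = 1 * (1 - qvar)"
    using qnumber_exact[of 1] by simp
  then have "qnumber 1 = 1"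
    using one_minus_qvar_power_nonzero[of 1] by (metis mult_right_cancel power_one_right zero_less_one)
  with 0 show ?thesis by (simp add: qbinomial_def)
next
  case (Suc l)
  let ?P = "qpochhammer qvar qvar"
  let ?a = "1 - qvar ^ Suc n" and ?b = "1 - qvar ^ n"
  define B where "B = qbinomial (2 * n) n"
  define B' where "B' = qbinomial (2 * n) (n + 1)"
  have B: "B * (?P n * ?P n) = ?P (2 * n)"
    using qbinomial_exact[of n "2 * n"] by (simp add: B_def mult_2)
  have "2 * n - (n + 1) = l" using Suc by simp
  then have B': "B' * (?P (Suc n) * ?P l) = ?P (2 * n)"
    using qbinomial_exact[of "n + 1" "2 * n"] Suc by (simp add: B'_def)
  have Pn: "?P n = ?P l * ?b" unfolding Suc by (rule qpochhammer_Suc)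
  have "(B * ?b) * (?P n * ?P l) = (B' * ?a) * (?P n * ?P l)"
  proof -
    have "(B * ?b) * (?P n * ?P l) = B * (?P n * (?P l * ?b))" by (simp only: mult_ac)
    also have "\<dots> = B' * (?P (Suc n) * ?P l)" using B B' Pn by metis
    also have "\<dots> = (B' * ?a) * (?P n * ?P l)"
      unfolding qpochhammer_Suc by (simp only: mult_ac)
    finally show ?thesis .
  qed
  then have rel: "B * ?b = B' * ?a"
    using qpochhammer_nonzero by simp
  have "(1 - qvar) * (qnumber (n + 1) * (B - qvar * B')) = ?a * B - qvar * (B' * ?a)"
  proof -
    have "(1 - qvar) * (qnumber (n + 1) * (B - qvar * B')) =
        (qnumber (n + 1) * (1 - qvar)) * (B - qvar * B')"
      by (simp only: mult_ac)
    also have "\<dots> = ?a * (B - qvar * B')" using qnumber_exact[of "n + 1"] by simp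
    also have "\<dots> = ?a * B - qvar * (B' * ?a)"
      by (simp only: right_diff_distrib mult_ac)
    finally show ?thesis .
  qed
  also have "\<dots> = (?a - qvar * ?b) * B"
    unfolding rel[symmetric] by (simp only: left_diff_distrib right_diff_distrib mult_ac)
  also have "?a - qvar * ?b = 1 - qvar"
    by (simp add: right_diff_distrib del: mult_pCons_left)
  finally have "qnumber (n + 1) * (B - qvar * B') = B"
    using one_minus_qvar_power_nonzero[of 1] by (metis mult_left_cancel power_one_right zero_less_one)
  then show ?thesis by (simp add: B_def B'_def)
qed

lemma qcatalan_exact: "qnumber (n + 1) * qcatalan n = qbinomial (2 * n) n"
  unfolding qcatalan_def using qcatalan_aux[of n] by (metis dvd_mult_div_cancel dvd_triv_left)

lemma qcatalan_altdef:
  "qcatalan n = qbinomial (2 * n) n - qvar * qbinomial (2 * n) (n + 1)"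
proof -
  have "qnumber (n + 1) \<noteq> 0"
    using qnumber_exact[of "n + 1"] one_minus_qvar_power_nonzero[of "n + 1"] by auto
  then show ?thesis
    using qcatalan_exact[of n] qcatalan_aux[of n] by (metis mult_left_cancel)
qed

lemma catalan_exact: "(n + 1) * catalan n = (2 * n) choose n"
proof -
  have "(n + 1) * ((2 * n) choose (n + 1)) = n * ((2 * n) choose n)"
  proof -
    have "Suc n * ((2 * n) choose Suc n) = (2 * n) * ((2 * n - 1) choose n)"
      by (rule binomial_absorption)
    also have "\<dots> = (2 * n - n) * ((2 * n) choose n)"
      by (rule binomial_absorb_comp[symmetric])
    finally show ?thesis by simp
  qed
  then have "(n + 1) dvd n * ((2 * n) choose n)" by (metis dvd_triv_left)
  moreover have "coprime (n + 1) n" by simp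
  ultimately have "(n + 1) dvd ((2 * n) choose n)" by (simp add: coprime_dvd_mult_right_iff)
  then show ?thesis unfolding catalan_def by (rule dvd_mult_div_cancel)
qed

definition poly_at :: "int poly \<Rightarrow> complex \<Rightarrow> complex" where
  "poly_at P z = poly (map_poly of_int P) z"

definition p_integral :: "nat \<Rightarrow> rat \<Rightarrow> bool" where
  "p_integral p x \<longleftrightarrow> coprime (snd (quotient_of x)) (int p)"

text \<open>
  Congruence modulo \<open>p\<close> in the ring of rational numbers with denominator prime to \<open>p\<close>.
  The library's \<open>cong\<close> is not available on \<open>rat\<close>.
\<close>

definition rat_cong :: "nat \<Rightarrow> rat \<Rightarrow> rat \<Rightarrow> bool" where
  "rat_cong p x y \<longleftrightarrow>
     p_integral p x \<and> p_integral p y \<and> (\<exists>z. p_integral p z \<and> x - y = of_nat p * z)"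

end

theory Submission
  imports Defs
begin

text \<open>
  Let \<open>[n, k]\<close> denote the Gaussian binomial and suppose \<open>[n, r] = 0\<close> for \<open>0 < r < n\<close>, as happens at a
  primitive \<open>n\<close>-th root of unity, and modulo \<open>p\<close> when \<open>q = 1\<close> and \<open>n = p^a\<close>. By Pascal's rule,
  \<open>[n - a, k]\<close> then agrees, up to sign and a power of \<open>q\<close>, with \<open>[a + k - 1, k]\<close>. This turns the sum of
  \<open>(-1)^k q^(-k(k-1)/2) C_k\<close> into \<open>E(n-1, 1/q) + E(n+1, q) - 2\<close>, where
  \<open>E(m, q)\<close> is the sum of \<open>q^(j^2) [m - j, j]\<close> over \<open>j\<close>. Schur's finite form of the
  Rogers--Ramanujan identity rewrites \<open>E(m, q)\<close> as the alternating sum of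
  \<open>(-1)^j q^(j(5j+1)/2) [m, floor((m - 5j)/2)]\<close>, of which for \<open>m = n\<close> and \<open>m = n + 1\<close> at most two terms
  survive; they determine \<open>E(n-1)\<close> as well, because \<open>E(n+1) = E(n) + q^n E(n-1)\<close>.
\<close>

section \<open>Gaussian binomial coefficients\<close>

text \<open>Pascal's rule instead of a quotient gives a meaning in every commutative ring, in
  particular at roots of unity, where the quotient can become 0/0.\<close>

fun gauss_binomial :: "'a::comm_ring_1 \<Rightarrow> nat \<Rightarrow> nat \<Rightarrow> 'a" where
  "gauss_binomial q n 0 = 1"
| "gauss_binomial q 0 (Suc k) = 0"
| "gauss_binomial q (Suc n) (Suc k) =
     gauss_binomial q n k + q ^ Suc k * gauss_binomial q n (Suc k)"

lemma gauss_binomial_eq_0: "n < k \<Longrightarrow> gauss_binomial q n k = 0"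
  by (induction q n k rule: gauss_binomial.induct) auto

lemma gauss_binomial_self [simp]: "gauss_binomial q n n = 1"
  by (induction n) (auto simp: gauss_binomial_eq_0)

text \<open>The mirror image of the defining Pascal rule: expanding by one rule and then by the
  other gives the same four products in either order.\<close>

lemma gauss_binomial_Suc_Suc':
  "gauss_binomial q (Suc n) (Suc k) =
     gauss_binomial q n (Suc k) + q ^ (n - k) * gauss_binomial q n k"
proof (induction n arbitrary: k)
  case 0
  then show ?case by (cases k) auto
next
  case (Suc n)
  show ?case
  proof (cases k)
    case 0
    have "gauss_binomial q (Suc (Suc n)) 1 = 1 + q * gauss_binomial q (Suc n) 1"
      by simp
    also have "gauss_binomial q (Suc n) 1 = gauss_binomial q n 1 + q ^ n"
      using Suc.IH[of 0] by simp
    also have "1 + q * (gauss_binomial q n 1 + q ^ n) =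
        gauss_binomial q (Suc n) 1 + q ^ Suc n"
      by (simp add: algebra_simps)
    finally show ?thesis using 0 by simp
  next
    case (Suc l)
    \<comment> \<open>For l < n the exponents on either side add up to n + 1; otherwise a
      subtraction truncates, but the coefficient is 0.\<close>
    have e: "q ^ Suc (Suc l) * q ^ (n - Suc l) * gauss_binomial q n (Suc l) =
        q ^ (n - l) * q ^ Suc l * gauss_binomial q n (Suc l)"
    proof (cases "l < n")
      case True
      then have "Suc (Suc l) + (n - Suc l) = n - l + Suc l" by simp
      then show ?thesis by (metis power_add)
    next
      case False
      then show ?thesis by (simp add: gauss_binomial_eq_0)
    qed
    have "gauss_binomial q (Suc (Suc n)) (Suc (Suc l)) =
        (gauss_binomial q n (Suc l) + q ^ (n - l) * gauss_binomial q n l) +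
        q ^ Suc (Suc l) * (gauss_binomial q n (Suc (Suc l)) +
          q ^ (n - Suc l) * gauss_binomial q n (Suc l))"
      by (subst gauss_binomial.simps(3)) (simp only: Suc.IH)
    also have "\<dots> = (gauss_binomial q n (Suc l) +
          q ^ Suc (Suc l) * gauss_binomial q n (Suc (Suc l))) +
        q ^ (n - l) * (gauss_binomial q n l + q ^ Suc l * gauss_binomial q n (Suc l))"
      using e by (simp only: distrib_left add_ac mult.assoc)
    also have "\<dots> = gauss_binomial q (Suc n) (Suc (Suc l)) +
        q ^ (Suc n - Suc l) * gauss_binomial q (Suc n) (Suc l)"
      by simp
    finally show ?thesis using Suc by simp
  qed
qed

lemma gauss_binomial_1: "gauss_binomial 1 n k = of_nat (n choose k)"
  by (induction "1::'a" n k rule: gauss_binomial.induct) auto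

text \<open>Links the recursion to the product formula, without division, so that it holds even
  where Pochhammer symbols vanish. The induction rests on (1 - q^(k+1)) + q^(k+1) (1 - q^(l+1)) = 1
  - q^(n+1) for n = k + l + 1.\<close>

lemma gauss_binomial_qpochhammer:
  "k \<le> n \<Longrightarrow> gauss_binomial q n k * (qpochhammer q q k * qpochhammer q q (n - k)) =
     qpochhammer q q n"
proof (induction q n k rule: gauss_binomial.induct)
  case (3 q n k)
  have S: "qpochhammer q q (Suc j) = qpochhammer q q j * (1 - q ^ Suc j)" for j
    by (simp add: qpochhammer_def)
  show ?case
  proof (cases "k = n")
    case True
    then show ?thesis using gauss_binomial_self[of q "Suc n"] by (simp add: qpochhammer_def)
  next
    case False
    with 3(3) have kn: "k < n" by simp
    then obtain l where n: "n = Suc (k + l)"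
      using less_imp_Suc_add by blast
    have 1: "gauss_binomial q n k * (qpochhammer q q k * qpochhammer q q (Suc l)) =
        qpochhammer q q n"
      using 3(1) n by (simp add: Suc_diff_le)
    have 2: "gauss_binomial q n (Suc k) * (qpochhammer q q (Suc k) * qpochhammer q q l) =
        qpochhammer q q n"
      using 3(2) n by simp
    have "gauss_binomial q (Suc n) (Suc k) *
        (qpochhammer q q (Suc k) * qpochhammer q q (Suc l)) =
        (gauss_binomial q n k * (qpochhammer q q k * qpochhammer q q (Suc l))) * (1 - q ^ Suc k) +
        q ^ Suc k * (1 - q ^ Suc l) *
        (gauss_binomial q n (Suc k) * (qpochhammer q q (Suc k) * qpochhammer q q l))"
      unfolding gauss_binomial.simps(3) S by (simp only: distrib_right distrib_left mult_ac)
    also have "\<dots> = qpochhammer q q n * (1 - q ^ Suc k * q ^ Suc l)"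
      unfolding 1 2 by (simp add: algebra_simps)
    also have "q ^ Suc k * q ^ Suc l = q ^ Suc n"
      using n by (simp add: power_add)
    finally show ?thesis using n S[of n] by (simp add: Suc_diff_le del: gauss_binomial.simps)
  qed
qed (auto simp: qpochhammer_def)

text \<open>Inverting the base exchanges the two Pascal rules: the coefficient at \<open>q\<close>
  is expanded by the second one, that at \<open>w\<close> by the first.\<close>

lemma gauss_binomial_inverse:
  assumes "q * w = 1" "k \<le> n"
  shows "gauss_binomial q n k = q ^ (k * (n - k)) * gauss_binomial w n k"
  using assms(2)
proof (induction n arbitrary: k)
  case (Suc n)
  show ?case
  proof (cases k)
    case (Suc l)
    show ?thesis
    proof (cases "l = n")
      case False
      with Suc Suc.prems obtain j where n: "n = Suc (l + j)"
        by (metis Suc_le_mono le_neq_implies_less less_imp_Suc_add)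
      let ?x = "gauss_binomial w n l" and ?y = "gauss_binomial w n (Suc l)"
      have 1: "gauss_binomial q n l = q ^ (l * Suc j) * ?x"
        using Suc.IH[of l] n by simp
      have 2: "gauss_binomial q n (Suc l) = q ^ (Suc l * j) * ?y"
        using Suc.IH[of "Suc l"] n by simp
      have "Suc l * Suc j = Suc l * j + Suc l"
        by simp
      then have "q ^ (Suc l * Suc j) * w ^ Suc l = q ^ (Suc l * j) * (q * w) ^ Suc l"
        by (simp only: power_add power_mult_distrib mult_ac)
      then have 3: "q ^ (Suc l * Suc j) * w ^ Suc l = q ^ (Suc l * j)"
        by (simp only: assms(1) power_one mult_1_right)
      have "Suc l * Suc j = Suc j + l * Suc j"
        by simp
      then have 4: "q ^ Suc j * q ^ (l * Suc j) = q ^ (Suc l * Suc j)"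
        by (simp only: power_add)
      have "n - l = Suc j" "Suc n - Suc l = Suc j"
        using n by auto
      then have "gauss_binomial q (Suc n) (Suc l) =
          q ^ (Suc l * j) * ?y + (q ^ Suc j * q ^ (l * Suc j)) * ?x"
        by (simp only: gauss_binomial_Suc_Suc' 1 2 mult.assoc)
      also have "\<dots> = q ^ (Suc l * Suc j) * (?x + w ^ Suc l * ?y)"
        by (simp only: 3[symmetric] 4 distrib_left mult.assoc add.commute)
      finally show ?thesis
        using n by (simp add: Suc)
    qed (use Suc gauss_binomial_self[of _ "Suc n"] in \<open>simp del: gauss_binomial.simps\<close>)
  qed simp
qed simp

section \<open>Reduction of the Catalan sum to Schur sums\<close>

text \<open>E(m, q) of the overview: a finite form of the Rogers--Ramanujan series with terms
  q^(j^2) / (q;q)_j, and the Fibonacci number F(m+1) at q = 1. Terms with 2 j > m vanish.\<close>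

definition schur_sum :: "'a::comm_ring_1 \<Rightarrow> nat \<Rightarrow> 'a" where
  "schur_sum q m = (\<Sum>j\<le>m. q ^ (j\<^sup>2) * gauss_binomial q (m - j) j)"

lemma schur_sum_Suc:
  "schur_sum q (Suc m) = 1 + (\<Sum>i\<le>m. q ^ ((Suc i)\<^sup>2) * gauss_binomial q (m - i) (Suc i))"
  unfolding schur_sum_def by (subst sum.atMost_Suc_shift) simp

text \<open>The second Pascal rule, applied termwise; the square exponents fit because (i+1)^2 + (m
  - 2 i) = (m+1) + i^2.\<close>

lemma schur_sum_rec:
  "schur_sum q (Suc (Suc m)) = schur_sum q (Suc m) + q ^ Suc m * schur_sum q m"
proof -
  have "q ^ ((Suc i)\<^sup>2) * gauss_binomial q (Suc m - i) (Suc i) =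
      q ^ ((Suc i)\<^sup>2) * gauss_binomial q (m - i) (Suc i) +
      q ^ Suc m * (q ^ (i\<^sup>2) * gauss_binomial q (m - i) i)" if "i \<le> m" for i
  proof (cases "i \<le> m - i")
    case True
    have e: "(Suc i)\<^sup>2 + (m - i - i) = Suc m + i\<^sup>2"
      using True that by (simp add: power2_eq_square)
    have "gauss_binomial q (Suc m - i) (Suc i) =
        gauss_binomial q (m - i) (Suc i) + q ^ (m - i - i) * gauss_binomial q (m - i) i"
      using that gauss_binomial_Suc_Suc'[of q "m - i" i] by (simp only: Suc_diff_le)
    then show ?thesis
      by (simp only: distrib_left mult.assoc[symmetric] power_add[symmetric] e)
  next
    case False
    then show ?thesis using that by (simp add: gauss_binomial_eq_0)
  qed
  then have "(\<Sum>i\<le>m. q ^ ((Suc i)\<^sup>2) * gauss_binomial q (Suc m - i) (Suc i)) =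
      (\<Sum>i\<le>m. q ^ ((Suc i)\<^sup>2) * gauss_binomial q (m - i) (Suc i)) +
      q ^ Suc m * schur_sum q m"
    by (simp add: schur_sum_def sum.distrib sum_distrib_left del: power_Suc)
  then show ?thesis
    by (simp add: schur_sum_Suc[of q "Suc m"] schur_sum_Suc[of q m])
qed

lemma choose_two_Suc: "Suc k choose 2 = (k choose 2) + k"
  by (simp add: numeral_2_eq_2)

text \<open>Divisibility by \<open>d\<close> covers both applications: \<open>d = 0\<close> gives equality at a root of unity,
  and \<open>q = 1\<close>, \<open>d = p\<close> gives congruence modulo \<open>p\<close>.\<close>

text \<open>This is the reflection \<open>[-a, k] = (-1)^k q^(-a k - k(k-1)/2) [a + k - 1, k]\<close> of the upper
  index, since \<open>n\<close> acts like \<open>0\<close>.\<close>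

lemma gauss_binomial_reflect:
  fixes q d :: "'a::comm_ring_1"
  assumes d: "\<And>r. 0 < r \<Longrightarrow> r < n \<Longrightarrow> d dvd gauss_binomial q n r"
  shows "a \<le> n \<Longrightarrow> k < n \<Longrightarrow>
    d dvd (- 1) ^ k * q ^ (a * k + (k choose 2)) * gauss_binomial q (n - a) k -
      gauss_binomial q (a + k - 1) k"
proof (induction a arbitrary: k)
  case 0
  show ?case
  proof (cases k)
    case (Suc l)
    \<comment> \<open>The first coefficient is [n, k] with 0 < k < n, divisible by \<open>d\<close>;
      the second one, [k-1, k], is 0.\<close>
    then show ?thesis
      using d[of k] 0 by (simp add: gauss_binomial_eq_0)
  qed (simp add: numeral_2_eq_2)
next
  case (Suc a)
  note IH = Suc.IH
  show ?case
    using Suc.prems(2)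
  proof (induction k)
    case 0
    show ?case by (simp add: numeral_2_eq_2)
  next
    case (Suc k)
    define X where "X = gauss_binomial q (n - Suc a)"
    have P: "gauss_binomial q (n - a) (Suc k) = X k + q ^ Suc k * X (Suc k)"
      using \<open>Suc a \<le> n\<close> gauss_binomial.simps(3)[of q "n - Suc a" k]
      by (simp add: Suc_diff_Suc X_def del: gauss_binomial.simps)
    have "a * Suc k + (Suc k choose 2) = a + (Suc a * k + (k choose 2))"
      by (simp add: choose_two_Suc)
    then have e1: "q ^ (a * Suc k + (Suc k choose 2)) = q ^ a * q ^ (Suc a * k + (k choose 2))"
      by (simp only: power_add)
    have "Suc a * Suc k + (Suc k choose 2) = Suc k + (a * Suc k + (Suc k choose 2))"
      by simp
    then have e2: "q ^ (Suc a * Suc k + (Suc k choose 2)) =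
        q ^ Suc k * q ^ (a * Suc k + (Suc k choose 2))"
      by (simp only: power_add)
    have Q: "gauss_binomial q (Suc a + Suc k - 1) (Suc k) =
        gauss_binomial q (a + k) (Suc k) + q ^ a * gauss_binomial q (a + k) k"
      using gauss_binomial_Suc_Suc'[of q "a + k" k] by (simp del: gauss_binomial.simps)
    \<comment> \<open>The error at (a+1, k+1) is the error at (a, k+1) plus q^a times the error at
      (a+1, k), which the outer and the inner induction supply.\<close>
    have "(- 1) ^ Suc k * q ^ (Suc a * Suc k + (Suc k choose 2)) * X (Suc k) -
          gauss_binomial q (Suc a + Suc k - 1) (Suc k) =
        ((- 1) ^ Suc k * q ^ (a * Suc k + (Suc k choose 2)) * gauss_binomial q (n - a) (Suc k) -
          gauss_binomial q (a + Suc k - 1) (Suc k)) +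
        q ^ a * ((- 1) ^ k * q ^ (Suc a * k + (k choose 2)) * X k -
          gauss_binomial q (Suc a + k - 1) k)"
      unfolding P Q e2 e1 by (simp add: algebra_simps)
    moreover have "d dvd ((- 1) ^ Suc k * q ^ (a * Suc k + (Suc k choose 2)) *
        gauss_binomial q (n - a) (Suc k) - gauss_binomial q (a + Suc k - 1) (Suc k))"
      using IH[of "Suc k"] Suc.prems \<open>Suc a \<le> n\<close> by simp
    moreover have "d dvd (- 1) ^ k * q ^ (Suc a * k + (k choose 2)) * X k -
        gauss_binomial q (Suc a + k - 1) k"
      using Suc unfolding X_def by simp
    ultimately show ?case
      unfolding X_def[symmetric] by (metis dvd_add dvd_mult)
  qed
qed

text \<open>A case of the q-Lucas phenomenon: each Pascal step adds a multiple of [n+a, n-1], which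
  reflects to [n-a-2, n-1] = 0.\<close>

lemma gauss_binomial_wrap:
  fixes q d :: "'a::comm_ring_1"
  assumes d: "\<And>r. 0 < r \<Longrightarrow> r < n \<Longrightarrow> d dvd gauss_binomial q n r"
    and n: "n > 0"
  shows "a < n \<Longrightarrow> d dvd gauss_binomial q (n + a) n - 1"
proof (induction a)
  case (Suc a)
  obtain l where l: "n = Suc l" using n by (cases n) auto
  have "d dvd gauss_binomial q (n + a) l"
    using gauss_binomial_reflect[OF d, where a = "Suc (Suc a)" and k = l] Suc.prems l
    by (simp add: gauss_binomial_eq_0 add.commute)
  moreover have "gauss_binomial q (n + Suc a) n - 1 = (gauss_binomial q (n + a) n - 1) +
      q ^ (n + a - l) * gauss_binomial q (n + a) l"
    using gauss_binomial_Suc_Suc'[of q "n + a" l] l by (simp del: gauss_binomial.simps)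
  ultimately show ?case
    using Suc by (metis Suc_lessD dvd_add dvd_mult)
qed simp

section \<open>Termwise reflection of the Catalan summands\<close>

context
  fixes q w d :: "'a::comm_ring_1" and n :: nat
  assumes d: "\<And>r. 0 < r \<Longrightarrow> r < n \<Longrightarrow> d dvd gauss_binomial q n r"
    and qw: "q * w = 1" and qn: "q ^ n = 1" and n: "n \<ge> 2"
begin

lemma pow_cancel: "q ^ (i + j) * w ^ i = q ^ j"
proof -
  have "q ^ (i + j) * w ^ i = (q * w) ^ i * q ^ j"
    by (simp only: power_add power_mult_distrib mult_ac)
  then show ?thesis by (simp add: qw)
qed

lemma sign_square: "(- 1) ^ k * ((- 1) ^ k * x) = (x::'a)"
  by (simp add: mult.assoc[symmetric] power_mult_distrib[symmetric])

text \<open>Reflection with a = k + 1 turns [2k, k] into [n-1-k, k]; the base then changes from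
  \<open>q\<close> to its inverse \<open>w\<close>, and q^n = 1 absorbs the remaining powers into
  w^(k^2).\<close>

lemma dvd_central:
  assumes k: "k < n"
  shows "d dvd (- 1) ^ k * w ^ (k choose 2) * gauss_binomial q (2 * k) k -
    w ^ (k\<^sup>2) * gauss_binomial w (n - 1 - k) k"
proof -
  define c where "c = k choose 2"
  have *: "q ^ (Suc k * k) * gauss_binomial q (n - Suc k) k =
      w ^ (k\<^sup>2) * gauss_binomial w (n - 1 - k) k"
  proof (cases "k \<le> n - Suc k")
    case True
    obtain j where "n - Suc k = k + j"
      using True le_Suc_ex by blast
    then have "n = Suc (2 * k + j)" "n - Suc k - k = j"
      using k by auto
    \<comment> \<open>The exponents add up to a multiple of n, so the other powers of q are the
      inverse of q^(k^2), that is w^(k^2).\<close>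
    then have "k\<^sup>2 + (Suc k * k + k * (n - Suc k - k)) = n * k"
      by (simp add: power2_eq_square algebra_simps)
    then have "q ^ (k\<^sup>2) * q ^ (Suc k * k + k * (n - Suc k - k)) = 1"
      by (simp only: power_add[symmetric] power_mult qn power_one)
    then have "w ^ (k\<^sup>2) = (q ^ (k\<^sup>2) * q ^ (Suc k * k + k * (n - Suc k - k))) * w ^ (k\<^sup>2)"
      by simp
    also have "\<dots> = (q * w) ^ (k\<^sup>2) * q ^ (Suc k * k + k * (n - Suc k - k))"
      by (simp only: power_mult_distrib mult_ac)
    finally have "w ^ (k\<^sup>2) = q ^ (Suc k * k) * q ^ (k * (n - Suc k - k))"
      by (simp add: qw power_add)
    then show ?thesis
      using gauss_binomial_inverse[OF qw True] by (simp only: mult.assoc) simp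
  next
    case False
    then show ?thesis by (simp add: gauss_binomial_eq_0)
  qed
  have "d dvd ((- 1) ^ k * w ^ c) *
      ((- 1) ^ k * q ^ (Suc k * k + c) * gauss_binomial q (n - Suc k) k -
       gauss_binomial q (2 * k) k)"
    using gauss_binomial_reflect[OF d, where a = "Suc k" and k = k] k
    unfolding c_def by (simp add: mult_2)
  also have "\<dots> = (- 1) ^ k * ((- 1) ^ k * (q ^ (c + Suc k * k) * w ^ c *
      gauss_binomial q (n - Suc k) k)) - (- 1) ^ k * w ^ c * gauss_binomial q (2 * k) k"
    by (simp only: right_diff_distrib mult_ac add.commute)
  finally show ?thesis
    unfolding sign_square pow_cancel * c_def[symmetric]
    by (metis dvd_minus_iff minus_diff_eq)
qed

text \<open>Reflection with a = k and lower index k + 1. The extra factor -1 accounts for the plus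
  sign, and the requirement k + 1 < n leaves k = n - 1 to be treated apart.\<close>

lemma dvd_shifted:
  assumes k: "Suc k < n"
  shows "d dvd (- 1) ^ k * w ^ (k choose 2) * (q * gauss_binomial q (2 * k) (Suc k)) +
    q ^ ((Suc k)\<^sup>2) * gauss_binomial q (n - k) (Suc k)"
proof -
  define c where "c = k choose 2"
  have e: "k * Suc k + (c + k) = c + (k * Suc k + k)" "q * q ^ (k * Suc k + k) = q ^ ((Suc k)\<^sup>2)"
    by (auto simp: power2_eq_square power_add mult_ac)
  have "d dvd ((- 1) ^ k * w ^ c * q) *
      ((- 1) ^ Suc k * q ^ (k * Suc k + (c + k)) * gauss_binomial q (n - k) (Suc k) -
       gauss_binomial q (2 * k) (Suc k))"
    using gauss_binomial_reflect[OF d, where a = k and k = "Suc k"] k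
    unfolding c_def choose_two_Suc by (simp add: mult_2)
  also have "\<dots> = - ((- 1) ^ k * ((- 1) ^ k * (q * (q ^ (c + (k * Suc k + k)) * w ^ c) *
      gauss_binomial q (n - k) (Suc k)))) -
      (- 1) ^ k * w ^ c * (q * gauss_binomial q (2 * k) (Suc k))"
    unfolding e(1) by (simp add: right_diff_distrib mult_ac)
  also have "\<dots> = - ((- 1) ^ k * w ^ c * (q * gauss_binomial q (2 * k) (Suc k)) +
    q ^ ((Suc k)\<^sup>2) * gauss_binomial q (n - k) (Suc k))"
    unfolding sign_square pow_cancel e(2) by simp
  finally show ?thesis by (simp only: dvd_minus_iff c_def)
qed

text \<open>At k = n - 1 the coefficient wraps around to 1, and the factor \<open>s\<close> in front
  of it is also 1 modulo \<open>d\<close>.\<close>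

lemma dvd_last:
  "d dvd (- 1) ^ (n - 1) * w ^ ((n - 1) choose 2) * (q * gauss_binomial q (2 * (n - 1)) n) - 1"
proof -
  obtain l where l: "n = Suc l" using n by (cases n) auto
  define c where "c = l choose 2"
  define s where "s = (- 1) ^ l * w ^ c * q"
  \<comment> \<open>For a = 1 and k = n - 1 both coefficients in the reflection are [n-1, n-1] = 1,
    so only the sign and the power of q remain.\<close>
  have "d dvd s * ((- 1) ^ l * q ^ (l + c) - 1)"
    using gauss_binomial_reflect[OF d, where a = 1 and k = l] n l unfolding c_def by simp
  also have "\<dots> = (- 1) ^ l * ((- 1) ^ l * (q * (q ^ (c + l) * w ^ c))) - s"
    unfolding s_def by (simp only: right_diff_distrib mult_ac mult_1_left add.commute)
  also have "\<dots> = 1 - s"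
    unfolding sign_square pow_cancel using qn l by simp
  finally have 1: "d dvd s - 1" by (simp only: dvd_minus_iff flip: minus_diff_eq[of 1 s])
  \<comment> \<open>2 (n-1) = n + (n-2) lies within the range of the wrap-around.\<close>
  have "n + (l - 1) = 2 * l" using n l by simp
  then have "d dvd s * (gauss_binomial q (2 * l) n - 1)"
    using gauss_binomial_wrap[OF d, where a = "l - 1"] n l by (metis diff_less dvd_mult zero_less_Suc less_Suc_eq_le diff_le_self)
  from dvd_add[OF this 1] show ?thesis
    unfolding l s_def c_def by (simp add: algebra_simps)
qed

text \<open>With S = E(n-1, w) and T = E(n+1, q), the central coefficients contribute S; the shifted
  ones contribute -(T - 1) over k < n - 1 and 1 at k = n - 1. Subtracting gives S + (T - 1) -
  1.\<close>

lemma dvd_catalan_sum: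
  "d dvd (\<Sum>k<n. (- 1) ^ k * w ^ (k choose 2) *
      (gauss_binomial q (2 * k) k - q * gauss_binomial q (2 * k) (Suc k))) -
    (schur_sum w (n - 1) + schur_sum q (Suc n) - 2)"
proof -
  obtain l where l: "n = Suc l" using n by (cases n) auto
  let ?s = "\<lambda>k. (- 1) ^ k * w ^ (k choose 2) :: 'a"
  have "d dvd (\<Sum>k<n. ?s k * gauss_binomial q (2 * k) k -
      w ^ (k\<^sup>2) * gauss_binomial w (n - 1 - k) k)"
    by (intro dvd_sum dvd_central) auto
  also have "\<dots> = (\<Sum>k<n. ?s k * gauss_binomial q (2 * k) k) - schur_sum w (n - 1)"
    unfolding schur_sum_def l by (simp add: sum_subtractf lessThan_Suc_atMost)
  finally have 1: "d dvd (\<Sum>k<n. ?s k * gauss_binomial q (2 * k) k) - schur_sum w (n - 1)" .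
  have "d dvd (\<Sum>k<l. ?s k * (q * gauss_binomial q (2 * k) (Suc k)) +
      q ^ ((Suc k)\<^sup>2) * gauss_binomial q (n - k) (Suc k))"
    by (intro dvd_sum dvd_shifted) (auto simp: l)
  \<comment> \<open>T - 1 has two further terms, with [1, n] and [0, n+1]; both vanish since n is at
    least 2.\<close>
  also have "\<dots> = (\<Sum>k<l. ?s k * (q * gauss_binomial q (2 * k) (Suc k))) +
      (schur_sum q (Suc n) - 1)"
    unfolding schur_sum_Suc using n l
    by (simp add: sum.distrib gauss_binomial_eq_0 flip: lessThan_Suc_atMost)
  finally have 2: "d dvd \<dots>" .
  have 3: "d dvd ?s l * (q * gauss_binomial q (2 * l) (Suc l)) - 1"
    using dvd_last l by simp
  have "d dvd (A - S) - (B + (T - 1)) - (c - 1) \<longleftrightarrow> d dvd A - (B + c) - (S + T - 2)" for A S B T c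
    by (simp add: algebra_simps)
  note rearrange = this
  show ?thesis
    using dvd_diff[OF dvd_diff[OF 1 2] 3]
    unfolding rearrange right_diff_distrib sum_subtractf by (simp add: l)
qed

end

section \<open>Schur's finite Rogers--Ramanujan identity\<close>

text \<open>Schur's sum runs over integers of either sign; with the value 0 outside the row, both
  Pascal rules hold at every integer index.\<close>

definition gauss_binomial_int :: "'a::comm_ring_1 \<Rightarrow> nat \<Rightarrow> int \<Rightarrow> 'a" where
  "gauss_binomial_int q n r = (if r < 0 then 0 else gauss_binomial q n (nat r))"

lemma gauss_binomial_int_eq_0: "r < 0 \<or> r > int n \<Longrightarrow> gauss_binomial_int q n r = 0"
  by (auto simp: gauss_binomial_int_def gauss_binomial_eq_0)

lemma gauss_binomial_int_Suc:
  fixes q :: "'a::field"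
  shows "gauss_binomial_int q (Suc n) r =
    gauss_binomial_int q n (r - 1) + q powi r * gauss_binomial_int q n r"
proof (cases "r > 0")
  case True
  then obtain k where r: "r = int (Suc k)"
    using zero_less_imp_eq_int[of r] by (auto simp: gr0_conv_Suc)
  then have "nat r = Suc k" "nat (r - 1) = k" "q powi r = q ^ Suc k" "\<not> r < 0" "\<not> r - 1 < 0"
    by (simp_all only: r power_int_of_nat)
  then show ?thesis by (simp add: gauss_binomial_int_def)
qed (auto simp: gauss_binomial_int_def)

lemma gauss_binomial_int_Suc':
  fixes q :: "'a::field"
  shows "gauss_binomial_int q (Suc n) r =
    gauss_binomial_int q n r + q powi (int n + 1 - r) * gauss_binomial_int q n (r - 1)"
proof (cases "r > 0")
  case True
  then obtain k where r: "r = int (Suc k)"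
    using zero_less_imp_eq_int[of r] by (auto simp: gr0_conv_Suc)
  show ?thesis
  proof (cases "k \<le> n")
    case True
    then have "int n + 1 - r = int (n - k)" using r by simp
    then have "q powi (int n + 1 - r) = q ^ (n - k)" by (simp only: power_int_of_nat)
    moreover have "nat r = Suc k" "nat (r - 1) = k" "\<not> r < 0" "\<not> r - 1 < 0"
      by (simp_all add: r)
    ultimately show ?thesis
      unfolding gauss_binomial_int_def by (simp only: gauss_binomial_Suc_Suc' if_False)
  qed (use r in \<open>simp add: gauss_binomial_int_eq_0\<close>)
qed (auto simp: gauss_binomial_int_def)

text \<open>In the exponent \<open>div\<close> is exact, since j (5 j + 1) is even; in the lower
  index it really rounds down, which makes the parity of m - j matter below.\<close>

definition schur_term :: "'a::field \<Rightarrow> nat \<Rightarrow> int \<Rightarrow> 'a" where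
  "schur_term q m j = (- 1) powi j * q powi (j * (5 * j + 1) div 2) *
     gauss_binomial_int q m ((int m - 5 * j) div 2)"

lemma sum_int_telescope:
  fixes W :: "int \<Rightarrow> 'a::ab_group_add"
  assumes "a \<le> b"
  shows "(\<Sum>j=a..b. W j - W (j + 1)) = W a - W (b + 1)"
  using assms
proof (induction b rule: int_ge_induct)
  case (step i)
  have "{a..i + 1} = insert (i + 1) {a..i}" using step by auto
  then show ?case using step by (simp add: add.commute)
qed simp

text \<open>For m - j even this is what the two Pascal rules leave over; for m - j odd the remainder
  is minus the same expression at j + 1.\<close>

definition schur_defect :: "'a::field \<Rightarrow> nat \<Rightarrow> int \<Rightarrow> 'a" where
  "schur_defect q m j = (if even (int m - j)
     then (- 1) powi j * q powi (j * (5 * j + 1) div 2 + (int m - 5 * j) div 2 + 1) *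
       gauss_binomial_int q m ((int m - 5 * j) div 2 + 1)
     else 0)"

text \<open>The defect of the recurrence at index \<open>j\<close> is cancelled by that at a neighbouring index of
  the other parity, so it telescopes.\<close>

lemma schur_term_rec:
  fixes q :: "'a::field"
  assumes q: "q \<noteq> 0"
  shows "schur_term q (Suc (Suc m)) j =
    schur_term q (Suc m) j + q ^ Suc m * schur_term q m j + (schur_defect q m j - schur_defect q m (j + 1))"
proof -
  define e where "e = j * (5 * j + 1) div 2"
  define s where "s = ((- 1) powi j :: 'a)"
  define r where "r = (int m - 5 * j) div 2"
  let ?G = "gauss_binomial_int q" and ?W = "schur_defect q m"
  have r2: "(int (Suc (Suc m)) - 5 * j) div 2 = r + 1"
    unfolding r_def by simp
  have pw: "q powi a * q powi b = q powi (a + b)" for a b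
    using q by (simp add: power_int_add)
  have alg1: "s * x * (A + u * B + c * C) = s * x * A + u * (s * x * B) + (s * (x * c) * C - 0)"
    and alg2: "s * x * (A + u * B + c * C) = s * x * A + u * (s * x * B) + (0 - - s * (x * c) * C)"
    for x A B C u c
    by (simp_all add: algebra_simps)
  have qm: "q ^ Suc m = q powi (int m + 1)"
    by (metis add.commute of_nat_Suc power_int_of_nat)
  show ?thesis
  proof (cases "even (int m - j)")
    case True
    then have m: "int m = 2 * r + 5 * j" unfolding r_def by fastforce
    then have r1: "(int (Suc m) - 5 * j) div 2 = r" by simp
    \<comment> \<open>Rows m and m + 1 share the index r here, so the first rule is applied, and
      then the second one to the factor of q^(r+1).\<close>
    have "?G (Suc (Suc m)) (r + 1) = ?G (Suc m) r +
        q powi (r + 1) * (?G m (r + 1) + q powi (int m - r) * ?G m r)"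
      using gauss_binomial_int_Suc[of q "Suc m" "r + 1"] gauss_binomial_int_Suc'[of q m "r + 1"]
      by simp
    also have "\<dots> = ?G (Suc m) r + q powi (int m + 1) * ?G m r + q powi (r + 1) * ?G m (r + 1)"
      by (simp add: distrib_left mult.assoc[symmetric] pw add.commute)
    finally have G: "?G (Suc (Suc m)) (r + 1) = \<dots>" .
    have "?W j = s * (q powi e * q powi (r + 1)) * ?G m (r + 1)"
      using True unfolding schur_defect_def pw by (simp add: s_def e_def r_def add.assoc)
    moreover have "?W (j + 1) = 0"
      using True unfolding schur_defect_def by simp
    ultimately show ?thesis
      unfolding schur_term_def r2 r1 G r_def[symmetric] e_def[symmetric] s_def[symmetric] qm
      by (simp only: alg1)
  next
    case False
    then have m: "int m = 2 * r + 5 * j + 1" unfolding r_def by presburger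
    then have r1: "(int (Suc m) - 5 * j) div 2 = r + 1" by simp
    \<comment> \<open>The rounded index is already r + 1 at row m + 1, so the two rules are used in
      the other order.\<close>
    have "?G (Suc (Suc m)) (r + 1) = ?G (Suc m) (r + 1) +
        q powi (int m + 1 - r) * (?G m (r - 1) + q powi r * ?G m r)"
      using gauss_binomial_int_Suc'[of q "Suc m" "r + 1"] gauss_binomial_int_Suc[of q m r]
      by (simp add: algebra_simps)
    also have "\<dots> = ?G (Suc m) (r + 1) + q powi (int m + 1) * ?G m r +
        q powi (int m + 1 - r) * ?G m (r - 1)"
      by (simp add: distrib_left mult.assoc[symmetric] pw add.commute)
    finally have G: "?G (Suc (Suc m)) (r + 1) = \<dots>" .
    \<comment> \<open>Passing to j + 1 raises the exponent by 5 j + 3 and lowers the rounded index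
      by 2, which identifies the remainder with the defect at j + 1.\<close>
    have "(j + 1) * (5 * (j + 1) + 1) = j * (5 * j + 1) + 2 * (5 * j + 3)"
      by (simp add: algebra_simps)
    then have "(j + 1) * (5 * (j + 1) + 1) div 2 = e + 5 * j + 3"
      unfolding e_def by simp
    moreover have "(int m - 5 * (j + 1)) div 2 = r - 2"
      using m by simp
    ultimately have "?W (j + 1) = - s * q powi (e + 5 * j + 3 + (r - 2) + 1) * ?G m (r - 2 + 1)"
      using False unfolding schur_defect_def by (simp add: s_def power_int_add)
    moreover have "e + 5 * j + 3 + (r - 2) + 1 = e + (int m + 1 - r)" "r - 2 + 1 = r - 1"
      using m by simp_all
    ultimately have "?W (j + 1) = - s * (q powi e * q powi (int m + 1 - r)) * ?G m (r - 1)"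
      unfolding pw by (simp only:)
    moreover have "?W j = 0"
      using False unfolding schur_defect_def by simp
    ultimately show ?thesis
      unfolding schur_term_def r2 r1 G r_def[symmetric] e_def[symmetric] s_def[symmetric] qm
      by (simp only: alg2)
  qed
qed

text \<open>Both sides obey the same two-step recurrence. Keeping the range \<open>K\<close> fixed
  while m varies lets the defects telescope.\<close>

theorem schur_sum_eq:
  fixes q :: "'a::field"
  assumes q: "q \<noteq> 0"
  shows "m \<le> K \<Longrightarrow> schur_sum q m = (\<Sum>j=-int K..int K. schur_term q m j)"
proof (induction m rule: induct_nat_012)
  case 0
  have "schur_term q 0 j = (if j = 0 then 1 else 0)" for j
    by (cases "j = 0") (auto simp: schur_term_def gauss_binomial_int_def gauss_binomial_eq_0)
  then show ?case by (simp add: schur_sum_def)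
next
  case 1
  have "schur_term q 1 j = (if j = 0 then 1 else 0)" for j
  proof (cases "j = 0")
    case False
    then have "(1 - 5 * j) div 2 < 0 \<or> (1 - 5 * j) div 2 > 1" by presburger
    then show ?thesis using False by (simp add: schur_term_def gauss_binomial_int_eq_0)
  qed (simp add: schur_term_def gauss_binomial_int_def)
  then show ?case by (simp add: schur_sum_def)
next
  case (ge2 m)
  let ?W = "schur_defect q m"
  have "(\<Sum>j=-int K..int K. ?W j - ?W (j + 1)) = ?W (- int K) - ?W (int K + 1)"
    by (rule sum_int_telescope) simp
  also have "\<dots> = 0"
  proof -
    \<comment> \<open>At both ends the lower index of the defect lies outside row m.\<close>
    have "(int m - 5 * (- int K)) div 2 + 1 > int m"
      using ge2.prems by linarith
    moreover have "(int m - 5 * (int K + 1)) div 2 + 1 < 0"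
      using ge2.prems by presburger
    ultimately show ?thesis
      by (simp add: schur_defect_def gauss_binomial_int_eq_0 del: minus_mult_right)
  qed
  finally have "(\<Sum>j=-int K..int K. schur_term q (Suc (Suc m)) j) =
      (\<Sum>j=-int K..int K. schur_term q (Suc m) j) +
      q ^ Suc m * (\<Sum>j=-int K..int K. schur_term q m j)"
    unfolding schur_term_rec[OF q]
    by (simp add: sum.distrib sum_distrib_left del: power_Suc)
  then show ?case
    using ge2 by (simp add: schur_sum_rec del: power_Suc)
qed

section \<open>The congruence modulo a prime\<close>

text \<open>Only the ends of row n survive. This serves q = 1 with d = p here, and d = 0 at a root
  of unity later.\<close>

lemma gauss_binomial_int_cong:
  fixes q d :: "'a::comm_ring_1"
  assumes d: "\<And>r. 0 < r \<Longrightarrow> r < n \<Longrightarrow> d dvd gauss_binomial q n r"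
  shows "d dvd gauss_binomial_int q n r - of_bool (r = 0 \<or> r = int n)"
proof (cases "0 < r \<and> r < int n")
  case True
  then have "0 < nat r" "nat r < n" by auto
  then show ?thesis using True d[of "nat r"] by (simp add: gauss_binomial_int_def)
qed (auto simp: gauss_binomial_int_def gauss_binomial_eq_0)

text \<open>Each entry combines two neighbours from row n, so each end of that row is seen twice;
  q^n = 1 makes its weight at index n trivial, and n >= 2 keeps the indices 1 and n apart.\<close>

lemma gauss_binomial_int_Suc_cong:
  fixes q d :: "'a::comm_ring_1"
  assumes d: "\<And>r. 0 < r \<Longrightarrow> r < n \<Longrightarrow> d dvd gauss_binomial q n r"
    and qn: "q ^ n = 1" and n: "n \<ge> 2"
  shows "d dvd gauss_binomial_int q (Suc n) r -
    of_bool (r = 0 \<or> r = 1 \<or> r = int n \<or> r = int n + 1)"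
proof (cases "0 < r \<and> r \<le> int n")
  case True
  then obtain k where r: "r = int (Suc k)"
    using zero_less_imp_eq_int[of r] by (auto simp: gr0_conv_Suc)
  have G: "gauss_binomial_int q (Suc n) r =
      gauss_binomial q n k + q ^ Suc k * gauss_binomial q n (Suc k)"
    by (simp add: gauss_binomial_int_def r del: of_nat_Suc)
  consider "k = 0" | "k = n - 1" | "0 < k" "k < n - 1"
    using True r by linarith
  then show ?thesis
  proof cases
    case 1
    then have "of_bool (r = 0 \<or> r = 1 \<or> r = int n \<or> r = int n + 1) = (1::'a)"
      using r by simp
    moreover have "d dvd gauss_binomial q n 1" using d n by simp
    ultimately show ?thesis unfolding G using 1 by simp
  next
    case 2
    then have "of_bool (r = 0 \<or> r = 1 \<or> r = int n \<or> r = int n + 1) = (1::'a)"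
      using r n by simp
    moreover have "d dvd gauss_binomial q n k" "Suc k = n" using d n 2 by simp_all
    ultimately show ?thesis unfolding G using qn by (simp del: power_Suc)
  next
    case 3
    then have "of_bool (r = 0 \<or> r = 1 \<or> r = int n \<or> r = int n + 1) = (0::'a)"
      using r n by auto
    moreover have "d dvd gauss_binomial q n k" "d dvd gauss_binomial q n (Suc k)"
      using d 3 by simp_all
    ultimately show ?thesis unfolding G by (simp del: power_Suc)
  qed
next
  case False
  then consider "r < 0" | "r = 0" | "r = int (Suc n)" | "r > int (Suc n)" by force
  then show ?thesis
    by cases (use gauss_binomial_self[of q "Suc n"] in
      \<open>simp_all add: gauss_binomial_int_def gauss_binomial_eq_0 nat_add_distrib del: gauss_binomial_self gauss_binomial.simps(3)\<close>)
qed

lemma Legendre_5: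
  "Legendre a 5 = (if a mod 5 = 0 then 0 else if a mod 5 = 1 \<or> a mod 5 = 4 then 1 else - 1)"
proof -
  have "QuadRes 5 a \<longleftrightarrow> a mod 5 \<in> {0, 1, 4}"
  proof
    assume "QuadRes 5 a"
    then obtain y where y: "y\<^sup>2 mod 5 = a mod 5"
      unfolding QuadRes_def cong_def by blast
    have "y\<^sup>2 mod 5 = ((y mod 5)\<^sup>2) mod 5"
      by (simp add: power_mod)
    moreover have "y mod 5 \<in> {0, 1, 2, 3, 4}" by auto
    ultimately show "a mod 5 \<in> {0, 1, 4}" using y by auto
  next
    assume "a mod 5 \<in> {0, 1, 4}"
    then have "0\<^sup>2 mod 5 = a mod 5 \<or> 1\<^sup>2 mod 5 = a mod 5 \<or> 2\<^sup>2 mod 5 = a mod 5"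
      by auto
    then show "QuadRes 5 a"
      unfolding QuadRes_def cong_def by blast
  qed
  then show ?thesis by (auto simp: Legendre_def cong_def)
qed

lemma minus_one_power_int:
  "(- 1 :: 'a::field) powi j = (if even j then 1 else - 1)"
proof (cases "even j")
  case True
  then obtain i where "j = 2 * i" by blast
  then show ?thesis by (simp add: power_int_mult)
next
  case False
  then obtain i where "j = 2 * i + 1" by (elim oddE)
  then show ?thesis by (simp add: power_int_mult power_int_add)
qed

text \<open>Schur's identity was proved over a field; at q = 1 every term is an integer, so it
  descends from the rationals.\<close>

lemma schur_sum_1:
  assumes "m \<le> K"
  shows "schur_sum (1::int) m =
    (\<Sum>j=-int K..int K. (if even j then 1 else - 1) *
      gauss_binomial_int 1 m ((int m - 5 * j) div 2))"
proof -
  have G: "gauss_binomial_int (1::rat) m r = of_int (gauss_binomial_int 1 m r)" for m r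
    by (simp add: gauss_binomial_int_def gauss_binomial_1)
  have "rat_of_int (schur_sum 1 m) = schur_sum 1 m"
    by (simp add: schur_sum_def gauss_binomial_1)
  also have "\<dots> = (\<Sum>j=-int K..int K. schur_term (1::rat) m j)"
    using assms by (simp add: schur_sum_eq)
  also have "\<dots> = of_int (\<Sum>j=-int K..int K. (if even j then 1 else - 1) *
      gauss_binomial_int 1 m ((int m - 5 * j) div 2))"
    unfolding schur_term_def G of_int_sum by (rule sum.cong) (auto simp: minus_one_power_int)
  finally show ?thesis by (simp only: of_int_eq_iff)
qed

text \<open>By absorption p^a divides r times the coefficient; if p did not divide the coefficient,
  p^a would divide r.\<close>

lemma prime_dvd_prime_power_choose:
  fixes p :: nat
  assumes p: "prime p" and r: "0 < r" "r < p ^ a"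
  shows "p dvd (p ^ a) choose r"
proof (rule ccontr)
  assume "\<not> p dvd (p ^ a) choose r"
  then have "coprime (p ^ a) ((p ^ a) choose r)"
    using p by (simp add: prime_imp_coprime)
  moreover have "p ^ a dvd r * ((p ^ a) choose r)"
    using r times_binomial_minus1_eq[of r "p ^ a"] by simp
  ultimately have "p ^ a dvd r"
    by (simp add: coprime_dvd_mult_left_iff)
  then show False using r by (simp add: nat_dvd_not_less)
qed

lemma catalan_eq_diff:
  "int (catalan k) = int ((2 * k) choose k) - int ((2 * k) choose (Suc k))"
proof -
  have "Suc k * ((2 * k) choose Suc k) = k * ((2 * k) choose k)"
    using binomial_absorption[of k "2 * k"] binomial_absorb_comp[of "2 * k" k, symmetric]
    by (simp only: mult_2 diff_add_inverse2)
  then have "int (Suc k) * int ((2 * k) choose Suc k) = int k * int ((2 * k) choose k)"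
    by (metis of_nat_mult)
  moreover have "int (Suc k) * int (catalan k) = int ((2 * k) choose k)"
    using catalan_exact[of k] by (metis Suc_eq_plus1 of_nat_mult)
  ultimately have "int (Suc k) * int (catalan k) =
      int (Suc k) * (int ((2 * k) choose k) - int ((2 * k) choose (Suc k)))"
    by (simp add: algebra_simps)
  then show ?thesis by (simp del: of_nat_Suc)
qed

lemma half_eq: "x div 2 = y \<longleftrightarrow> x = 2 * y \<or> x = 2 * y + 1" for x y :: int
  by presburger

text \<open>Finds the surviving j in Schur's sum for row N by the residue of N modulo 5; the next
  lemma does the same for row N + 1.\<close>

lemma half_index:
  fixes N t j :: int
  shows "N = 5 * t \<Longrightarrow>
    (N - 5 * j) div 2 = 0 \<or> (N - 5 * j) div 2 = N \<longleftrightarrow> j = t \<or> j = - t"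
  and "N = 5 * t + 1 \<Longrightarrow>
    (N - 5 * j) div 2 = 0 \<or> (N - 5 * j) div 2 = N \<longleftrightarrow> j = t"
  and "N = 5 * t + 2 \<Longrightarrow>
    (N - 5 * j) div 2 = 0 \<or> (N - 5 * j) div 2 = N \<longleftrightarrow> False"
  and "N = 5 * t + 3 \<Longrightarrow>
    (N - 5 * j) div 2 = 0 \<or> (N - 5 * j) div 2 = N \<longleftrightarrow> False"
  and "N = 5 * t + 4 \<Longrightarrow>
    (N - 5 * j) div 2 = 0 \<or> (N - 5 * j) div 2 = N \<longleftrightarrow> j = - t - 1"
  unfolding half_eq by presburger+

lemma half_index_Suc:
  fixes N t j :: int
  shows "N = 5 * t \<Longrightarrow>
    (N + 1 - 5 * j) div 2 = 0 \<or> (N + 1 - 5 * j) div 2 = 1 \<or>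
    (N + 1 - 5 * j) div 2 = N \<or> (N + 1 - 5 * j) div 2 = N + 1 \<longleftrightarrow> j = t \<or> j = - t"
  and "N = 5 * t + 1 \<Longrightarrow>
    (N + 1 - 5 * j) div 2 = 0 \<or> (N + 1 - 5 * j) div 2 = 1 \<or>
    (N + 1 - 5 * j) div 2 = N \<or> (N + 1 - 5 * j) div 2 = N + 1 \<longleftrightarrow> j = t \<or> j = - t"
  and "N = 5 * t + 2 \<Longrightarrow>
    (N + 1 - 5 * j) div 2 = 0 \<or> (N + 1 - 5 * j) div 2 = 1 \<or>
    (N + 1 - 5 * j) div 2 = N \<or> (N + 1 - 5 * j) div 2 = N + 1 \<longleftrightarrow> j = t"
  and "N = 5 * t + 3 \<Longrightarrow>
    (N + 1 - 5 * j) div 2 = 0 \<or> (N + 1 - 5 * j) div 2 = 1 \<or>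
    (N + 1 - 5 * j) div 2 = N \<or> (N + 1 - 5 * j) div 2 = N + 1 \<longleftrightarrow> j = - t - 1"
  and "N = 5 * t + 4 \<Longrightarrow>
    (N + 1 - 5 * j) div 2 = 0 \<or> (N + 1 - 5 * j) div 2 = 1 \<or>
    (N + 1 - 5 * j) div 2 = N \<or> (N + 1 - 5 * j) div 2 = N + 1 \<longleftrightarrow> j = - t - 1 \<or> j = t + 1"
  unfolding half_eq by presburger+

text \<open>At q = 1 the recurrence gives E(n-1) = E(n+1) - E(n), so the sum is 2 E(n+1) - E(n) - 2
  modulo p. At most two signs survive in each of E(n) and E(n+1).\<close>

lemma catalan_sum_cong:
  assumes p: "prime p" and a: "a > 0"
  shows "[\<Sum>k<p ^ a. (- 1) ^ k * int (catalan k) =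
    (if p ^ a mod 5 = 1 \<or> p ^ a mod 5 = 4 then 1 else - 4)] (mod int p)"
proof -
  define n where "n = p ^ a"
  have n: "n \<ge> 2"
    using p a self_le_power[of p a] prime_ge_2_nat[OF p] unfolding n_def by linarith
  have d: "int p dvd gauss_binomial 1 n r" if "0 < r" "r < n" for r
    using prime_dvd_prime_power_choose[OF p] that unfolding n_def
    by (simp add: gauss_binomial_1)
  define K where "K = Suc n"
  define sg where "sg j = (if even j then 1 else - 1 :: int)" for j :: int
  let ?J = "{-int K..int K}"
  \<comment> \<open>Modulo p the row entries become indicators, and only the signs at the surviving
    indices are left.\<close>
  have sum_sg: "[(\<Sum>j\<in>?J. sg j * g j) = (\<Sum>j\<in>S. sg j)] (mod int p)"
    if "\<And>j. int p dvd g j - of_bool (P j)" "\<And>j. P j \<longleftrightarrow> j \<in> S" "S \<subseteq> ?J" for g P S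
  proof -
    have "[(\<Sum>j\<in>?J. sg j * g j) = (\<Sum>j\<in>?J. sg j * of_bool (P j))] (mod int p)"
      using that(1) by (intro cong_sum cong_mult cong_refl) (simp add: cong_iff_dvd_diff)
    also have "(\<Sum>j\<in>?J. sg j * of_bool (P j)) = (\<Sum>j\<in>?J \<inter> {j. P j}. sg j)"
      by simp
    also have "?J \<inter> {j. P j} = S" using that(2,3) by blast
    finally show ?thesis .
  qed
  have An: "[schur_sum 1 n = (\<Sum>j\<in>S. sg j)] (mod int p)"
    if "\<And>j. (int n - 5 * j) div 2 = 0 \<or> (int n - 5 * j) div 2 = int n \<longleftrightarrow> j \<in> S" "S \<subseteq> ?J" for S
    using sum_sg[OF gauss_binomial_int_cong[OF d] that]
      schur_sum_1[of n K] unfolding K_def sg_def by simp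
  have An1: "[schur_sum 1 (Suc n) = (\<Sum>j\<in>S. sg j)] (mod int p)"
    if "\<And>j. (int n + 1 - 5 * j) div 2 = 0 \<or> (int n + 1 - 5 * j) div 2 = 1 \<or>
      (int n + 1 - 5 * j) div 2 = int n \<or> (int n + 1 - 5 * j) div 2 = int n + 1 \<longleftrightarrow> j \<in> S"
      "S \<subseteq> ?J" for S
    using sum_sg[OF gauss_binomial_int_Suc_cong[OF d], where S = S] that n
      schur_sum_1[of "Suc n" K] unfolding K_def sg_def by (simp add: add.commute)
  \<comment> \<open>An even n forces p = 2, where 1 and -1 agree; so signs need only be determined
    for odd n.\<close>
  have sg_cong: "[sg j = e] (mod int p)" if "odd n \<Longrightarrow> sg j = e" "e = 1 \<or> e = - 1" for j e
  proof (cases "odd n")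
    case False
    then have "p = 2" using p unfolding n_def by (metis even_power primes_dvd_imp_eq two_is_prime_nat)
    then show ?thesis using that(2) by (auto simp: cong_iff_dvd_diff sg_def)
  qed (use that in simp)
  define t where "t = int n div 5"
  \<comment> \<open>The values of E(n) and E(n+1) modulo p. For odd n the residue of n modulo 5
    fixes the parity of t, hence the signs.\<close>
  define A B where
    "A = (if n mod 5 = 0 then - 2 else if n mod 5 = 1 \<or> n mod 5 = 4 then 1 else 0 :: int)" and
    "B = (if n mod 5 = 0 then - 2 else if n mod 5 = 1 \<or> n mod 5 = 4 then 2 else - 1 :: int)"
  have "[schur_sum 1 n = A] (mod int p) \<and> [schur_sum 1 (Suc n) = B] (mod int p)"
  proof -
    have "int n = 5 * t + int (n mod 5)" "n mod 5 < 5"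
      unfolding t_def by (simp_all add: zmod_int)
    then consider "int n = 5 * t" "n mod 5 = 0" | "int n = 5 * t + 1" "n mod 5 = 1" |
      "int n = 5 * t + 2" "n mod 5 = 2" | "int n = 5 * t + 3" "n mod 5 = 3" |
      "int n = 5 * t + 4" "n mod 5 = 4"
      by force
    then show ?thesis
    proof cases
      case 1
      have "[sg t = - 1] (mod int p)" "[sg (- t) = - 1] (mod int p)"
        by (rule sg_cong; use 1 in \<open>simp add: sg_def; presburger\<close>)+
      from cong_add[OF this] have "[(\<Sum>j\<in>{t, -t}. sg j) = A] (mod int p)"
        using 1 n by (simp add: A_def)
      moreover have "[schur_sum 1 n = (\<Sum>j\<in>{t, -t}. sg j)] (mod int p)"
        by (rule An, simp only: half_index(1)[OF 1(1)] insert_iff empty_iff simp_thms)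
          (use 1 n in \<open>auto simp: K_def\<close>)
      moreover have "[schur_sum 1 (Suc n) = (\<Sum>j\<in>{t, -t}. sg j)] (mod int p)"
        by (rule An1, simp only: half_index_Suc(1)[OF 1(1)] insert_iff empty_iff simp_thms)
          (use 1 n in \<open>auto simp: K_def\<close>)
      moreover have "B = A"
        using 1 by (simp add: A_def B_def)
      ultimately show ?thesis by (auto intro: cong_trans)
    next
      case 2
      have e: "[sg t = 1] (mod int p)"
        by (rule sg_cong; use 2 in \<open>simp add: sg_def; presburger\<close>)
      have "[schur_sum 1 n = (\<Sum>j\<in>{t}. sg j)] (mod int p)"
        by (rule An, simp only: half_index(2)[OF 2(1)] insert_iff empty_iff simp_thms)
          (use 2 n in \<open>auto simp: K_def\<close>)
      moreover have "[schur_sum 1 (Suc n) = (\<Sum>j\<in>{t, -t}. sg j)] (mod int p)"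
        by (rule An1, simp only: half_index_Suc(2)[OF 2(1)] insert_iff empty_iff simp_thms)
          (use 2 n in \<open>auto simp: K_def\<close>)
      moreover have "(\<Sum>j\<in>{t, -t}. sg j) = sg t + sg t"
        using 2 n by (simp add: sg_def)
      ultimately show ?thesis
        using cong_trans[OF _ e] cong_trans[OF _ cong_add[OF e e]] 2 by (simp add: A_def B_def)
    next
      case 3
      have e: "[sg t = - 1] (mod int p)"
        by (rule sg_cong; use 3 in \<open>simp add: sg_def; presburger\<close>)
      have "[schur_sum 1 n = (\<Sum>j\<in>{}. sg j)] (mod int p)"
        by (rule An, simp only: half_index(3)[OF 3(1)] insert_iff empty_iff simp_thms)
          (use 3 n in \<open>auto simp: K_def\<close>)
      moreover have "[schur_sum 1 (Suc n) = (\<Sum>j\<in>{t}. sg j)] (mod int p)"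
        by (rule An1, simp only: half_index_Suc(3)[OF 3(1)] insert_iff empty_iff simp_thms)
          (use 3 n in \<open>auto simp: K_def\<close>)
      ultimately show ?thesis
        using cong_trans[OF _ e] 3 by (simp add: A_def B_def)
    next
      case 4
      have e: "[sg (- t - 1) = - 1] (mod int p)"
        by (rule sg_cong; use 4 in \<open>simp add: sg_def; presburger\<close>)
      have "[schur_sum 1 n = (\<Sum>j\<in>{}. sg j)] (mod int p)"
        by (rule An, simp only: half_index(4)[OF 4(1)] insert_iff empty_iff simp_thms)
          (use 4 n in \<open>auto simp: K_def\<close>)
      moreover have "[schur_sum 1 (Suc n) = (\<Sum>j\<in>{- t - 1}. sg j)] (mod int p)"
        by (rule An1, simp only: half_index_Suc(4)[OF 4(1)] insert_iff empty_iff simp_thms)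
          (use 4 n in \<open>auto simp: K_def\<close>)
      ultimately show ?thesis
        using cong_trans[OF _ e] 4 by (simp add: A_def B_def)
    next
      case 5
      have e: "[sg (- t - 1) = 1] (mod int p)" "[sg (t + 1) = 1] (mod int p)"
        by (rule sg_cong; use 5 in \<open>simp add: sg_def; presburger\<close>)+
      have "[schur_sum 1 n = (\<Sum>j\<in>{- t - 1}. sg j)] (mod int p)"
        by (rule An, simp only: half_index(5)[OF 5(1)] insert_iff empty_iff simp_thms)
          (use 5 n in \<open>auto simp: K_def\<close>)
      moreover have "[schur_sum 1 (Suc n) = (\<Sum>j\<in>{- t - 1, t + 1}. sg j)] (mod int p)"
        by (rule An1, simp only: half_index_Suc(5)[OF 5(1)] insert_iff empty_iff simp_thms)
          (use 5 n in \<open>auto simp: K_def\<close>)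
      moreover have "(\<Sum>j\<in>{- t - 1, t + 1}. sg j) = sg (- t - 1) + sg (t + 1)"
        using 5 n by simp
      ultimately show ?thesis
        using cong_trans[OF _ e(1)] cong_trans[OF _ cong_add[OF e]] 5 by (simp add: A_def B_def)
    qed
  qed
  then have AB: "[2 * schur_sum 1 (Suc n) - schur_sum 1 n - 2 = 2 * B - A - 2] (mod int p)"
    by (intro cong_diff cong_mult cong_refl) auto
  have "schur_sum (1::int) (Suc n) = schur_sum 1 n + schur_sum 1 (n - 1)"
    using schur_sum_rec[of "1::int" "n - 1"] n by simp
  then have "[(\<Sum>k<n. (- 1) ^ k * int (catalan k)) =
      2 * schur_sum 1 (Suc n) - schur_sum 1 n - 2] (mod int p)"
    using dvd_catalan_sum[OF d, of 1] n
    by (simp add: gauss_binomial_1 catalan_eq_diff cong_iff_dvd_diff add.commute)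
  from cong_trans[OF this AB]
  have "[(\<Sum>k<n. (- 1) ^ k * int (catalan k)) = 2 * B - A - 2] (mod int p)" .
  also have "2 * B - A - 2 = (if n mod 5 = 1 \<or> n mod 5 = 4 then 1 else - 4)"
    by (simp add: A_def B_def)
  finally show ?thesis unfolding n_def .
qed

section \<open>Roots of unity\<close>

text \<open>Both satisfy the same product equation, and the nonzero Pochhammer factors cancel in
  \<open>int poly\<close>.\<close>

lemma qbinomial_eq_gauss_binomial: "qbinomial n k = gauss_binomial qvar n k"
proof (cases "k \<le> n")
  case True
  then show ?thesis
    using qbinomial_exact[OF True] gauss_binomial_qpochhammer[OF True, of qvar]
      qpochhammer_nonzero by (metis mult_cancel_right no_zero_divisors)
qed (simp add: qbinomial_def gauss_binomial_eq_0)

section \<open>Evaluation of integer polynomials at a complex number\<close>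

lemma poly_at_add: "poly_at (P + Q) z = poly_at P z + poly_at Q z"
  unfolding poly_at_def by (simp add: poly_eqI coeff_map_poly flip: poly_add)
    (rule arg_cong[where f = "\<lambda>p. poly p z"], rule poly_eqI, simp add: coeff_map_poly)

lemma poly_at_diff: "poly_at (P - Q) z = poly_at P z - poly_at Q z"
  using poly_at_add[of "P - Q" Q z] by simp

lemma poly_at_mult: "poly_at (P * Q) z = poly_at P z * poly_at Q z"
proof -
  have "map_poly of_int (P * Q) = (map_poly of_int P * map_poly of_int Q :: complex poly)"
    by (rule poly_eqI) (simp add: coeff_map_poly coeff_mult)
  then show ?thesis by (simp add: poly_at_def)
qed

lemma poly_at_qvar: "poly_at qvar z = z"
  by (simp add: poly_at_def map_poly_pCons)

lemma poly_at_0: "poly_at 0 z = 0"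
  by (simp add: poly_at_def)

lemma poly_at_1: "poly_at 1 z = 1"
  by (simp add: poly_at_def)

lemma poly_at_power: "poly_at (P ^ k) z = poly_at P z ^ k"
  by (induction k) (simp_all add: poly_at_1 poly_at_mult)

lemma poly_at_gauss_binomial: "poly_at (gauss_binomial qvar n k) z = gauss_binomial z n k"
proof (induction z n k rule: gauss_binomial.induct)
  case (3 z n k)
  show ?case
    unfolding gauss_binomial.simps poly_at_add poly_at_mult poly_at_power poly_at_qvar 3 ..
qed (simp_all add: poly_at_0 poly_at_1)

lemma poly_at_qcatalan:
  "poly_at (qcatalan k) z = gauss_binomial z (2 * k) k - z * gauss_binomial z (2 * k) (Suc k)"
  unfolding qcatalan_altdef
  by (simp only: qbinomial_eq_gauss_binomial poly_at_diff poly_at_mult poly_at_qvar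
      poly_at_gauss_binomial Suc_eq_plus1)

text \<open>In the product formula (q;q)_n vanishes, while the Pochhammer symbols of length r and n
  - r do not.\<close>

lemma gauss_binomial_root_of_unity:
  fixes q :: "'a::idom"
  assumes "q ^ n = 1" and prim: "\<And>j. 0 < j \<Longrightarrow> j < n \<Longrightarrow> q ^ j \<noteq> 1" and r: "0 < r" "r < n"
  shows "gauss_binomial q n r = 0"
proof -
  have "qpochhammer q q k \<noteq> 0" if "k < n" for k
    using prim that by (auto simp: qpochhammer_def simp flip: power_Suc)
  moreover have "qpochhammer q q n = 0"
  proof -
    \<comment> \<open>The factor of (q;q)_n at j = n - 1 is 1 - q^n.\<close>
    have "n - 1 < n" "1 - q * q ^ (n - 1) = 0"
      using assms by (auto simp flip: power_Suc)
    then show ?thesis unfolding qpochhammer_def by (meson finite_lessThan lessThan_iff prod_zero)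
  qed
  ultimately show ?thesis
    using gauss_binomial_qpochhammer[of r n q] r by simp
qed

text \<open>For n = 5 t the same two indices, t and -t, survive in rows n and n + 1. That the two
  values agree later forces E(n-1) = 0.\<close>

lemma schur_sum_root_of_unity:
  fixes q :: "'a::field"
  assumes d: "\<And>r. 0 < r \<Longrightarrow> r < n \<Longrightarrow> gauss_binomial q n r = 0"
    and qn: "q ^ n = 1" and n: "n = 5 * t" "t > 0"
  defines "S \<equiv> (- 1) ^ t * (q powi (int t * (5 * int t + 1) div 2) +
    q powi (int t * (5 * int t - 1) div 2))"
  shows "schur_sum q n = S" and "schur_sum q (Suc n) = S"
proof -
  have q: "q \<noteq> 0" using qn n by (auto simp: power_0_left)
  define K where "K = Suc n"
  define s where "s j = (- 1) powi j * q powi (j * (5 * j + 1) div 2)" for j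
  let ?J = "{-int K..int K}"
  have st: "s (int t) + s (- int t) = S"
  proof -
    have "- int t * (5 * (- int t) + 1) = int t * (5 * int t - 1)" by (simp add: algebra_simps)
    then show ?thesis
      unfolding s_def S_def by (simp add: minus_one_power_int distrib_left)
  qed
  have sum_s: "(\<Sum>j\<in>?J. s j * of_bool (P j)) = S"
    if "{j \<in> ?J. P j} = {int t, - int t}" for P
  proof -
    have "(\<Sum>j\<in>?J. s j * of_bool (P j)) = (\<Sum>j\<in>?J \<inter> {j. P j}. s j)"
      by simp
    also have "?J \<inter> {j. P j} = {int t, - int t}" using that by blast
    finally show ?thesis using n st by simp
  qed
  have "gauss_binomial_int q n r = of_bool (r = 0 \<or> r = int n)" for r
    using gauss_binomial_int_cong[of n 0 q r] d by simp
  then have "schur_sum q n =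
      (\<Sum>j\<in>?J. s j * of_bool ((int n - 5 * j) div 2 = 0 \<or> (int n - 5 * j) div 2 = int n))"
    using schur_sum_eq[OF q, of n K] by (simp add: K_def schur_term_def s_def)
  also have "\<dots> = S"
    by (rule sum_s) (use n in \<open>auto simp: K_def\<close>)
  finally show "schur_sum q n = S" .
  have "gauss_binomial_int q (Suc n) r = of_bool (r = 0 \<or> r = 1 \<or> r = int n \<or> r = int n + 1)" for r
    using gauss_binomial_int_Suc_cong[of n 0 q r] d qn n by simp
  then have "schur_sum q (Suc n) =
      (\<Sum>j\<in>?J. s j * of_bool ((int (Suc n) - 5 * j) div 2 = 0 \<or> (int (Suc n) - 5 * j) div 2 = 1 \<or>
        (int (Suc n) - 5 * j) div 2 = int n \<or> (int (Suc n) - 5 * j) div 2 = int n + 1))"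
    using schur_sum_eq[OF q, of "Suc n" K] by (simp add: K_def schur_term_def s_def)
  also have "\<dots> = S"
    by (rule sum_s) (use n in \<open>auto simp: K_def\<close>)
  finally show "schur_sum q (Suc n) = S" .
qed

text \<open>Doubling the angles gives x = 2 y^2 - 1 and -y = 2 x^2 - 1; their difference factors and
  leaves y - x = 1/2, hence a quadratic equation for y.\<close>

lemma cos_pi_5: "cos (pi / 5) = (1 + sqrt 5) / 4"
  and cos_2pi_5: "cos (2 * pi / 5) = (sqrt 5 - 1) / 4"
proof -
  define x y where "x = cos (2 * pi / 5)" and "y = cos (pi / 5)"
  have "x > 0" "y > 0"
    unfolding x_def y_def by (auto intro!: cos_gt_zero)
  have "x = 2 * y\<^sup>2 - 1"
    using cos_double_cos[of "pi / 5"] by (simp add: x_def y_def)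
  moreover have "- y = 2 * x\<^sup>2 - 1"
    using cos_double_cos[of "2 * pi / 5"] cos_pi_minus[of "pi / 5"]
    by (simp add: x_def y_def field_simps)
  ultimately have "(x + y) * (2 * (y - x) - 1) = 0"
    by (simp add: power2_eq_square algebra_simps)
  then have xy: "x = y - 1 / 2"
    using \<open>x > 0\<close> \<open>y > 0\<close> by simp
  with \<open>x = 2 * y\<^sup>2 - 1\<close> have "(4 * y - 1)\<^sup>2 = 5"
    by (simp add: power2_eq_square algebra_simps)
  moreover have "4 * y - 1 \<ge> 0" using xy \<open>x > 0\<close> by simp
  ultimately have "4 * y - 1 = sqrt 5"
    by (metis real_sqrt_unique)
  then show "cos (pi / 5) = (1 + sqrt 5) / 4" "cos (2 * pi / 5) = (sqrt 5 - 1) / 4"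
    using xy unfolding x_def y_def by simp_all
qed

text \<open>The sign, the cosine and the Legendre symbol depend only on m modulo 10, which leaves
  eight residues to check.\<close>

lemma cos_mult_pi_5:
  assumes "\<not> 5 dvd m"
  shows "(if odd m then 1 else - 1) * (2 * cos (pi * of_int m / 5)) =
    1 / 2 * (1 + sqrt 5 * of_int (Legendre m 5))"
proof -
  define c where "c = m mod 10"
  define k where "k = m div 10"
  have m: "m = c + 10 * k" unfolding c_def k_def by simp
  have "pi * of_int m / 5 = pi * of_int c / 5 + 2 * pi * of_int k"
    unfolding m by (simp add: field_simps)
  then have 1: "cos (pi * of_int m / 5) = cos (pi * of_int c / 5)"
    by (simp only: cos_add) (simp add: cos_int_2pin sin_int_2pin)
  have 2: "odd m \<longleftrightarrow> odd c" unfolding m by simp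
  have 3: "m mod 5 = c mod 5" unfolding m by presburger
  have "0 \<le> c" "c < 10" "c \<noteq> 0" "c \<noteq> 5"
    using assms m unfolding c_def by auto
  then have c: "c \<in> {1, 2, 3, 4, 6, 7, 8, 9}"
    unfolding insert_iff empty_iff by presburger
  have arg: "pi * 2 / 5 = 2 * pi / 5" "pi * 3 / 5 = pi - 2 * pi / 5" "pi * 4 / 5 = pi - pi / 5"
    "pi * 6 / 5 = pi / 5 + pi" "pi * 7 / 5 = 2 * pi / 5 + pi"
    "pi * 8 / 5 = 2 * pi - 2 * pi / 5" "pi * 9 / 5 = 2 * pi - pi / 5"
    by simp_all
  show ?thesis
    unfolding 1 2 Legendre_5 3 using c
    by (elim insertE emptyE; hypsubst)
      (simp_all only: of_int_numeral of_int_1 mult_1_right arg cos_pi_minus cos_periodic_pi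
        cos_2pi_minus cos_pi_5 cos_2pi_5, simp_all add: field_simps)
qed

text \<open>Since n = 5 t, the two powers of q are (-1)^(m t) times exp(pi i m / 5) and exp(-pi i m
  / 5), which add up to twice a cosine.\<close>

lemma schur_value_cis:
  fixes m :: int
  assumes n: "n = 5 * t" "t > 0" and cop: "coprime (int n) m"
  defines "q \<equiv> cis (2 * pi * of_int m / of_nat n)"
  shows "(- 1) ^ t * (q powi (int t * (5 * int t + 1) div 2) +
      q powi (int t * (5 * int t - 1) div 2)) =
    of_real (1 / 2 * (1 + sqrt 5 * of_int (Legendre m 5)))"
proof -
  define b where "b = pi * of_int m / 5"
  have pow: "q powi e = cis (of_int (m * int t) * pi) * cis (of_int \<sigma> * b)"
    if "2 * e = int t * (5 * int t + \<sigma>)" for e \<sigma>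
  proof -
    have "of_int (2 * e) = (of_int (int t * (5 * int t + \<sigma>)) :: real)" using that by simp
    then have "2 * of_int e = of_nat t * (5 * of_nat t + (of_int \<sigma> :: real))" by simp
    moreover have "of_int e * (2 * pi * of_int m / of_nat n) = 2 * of_int e * (pi * of_int m / of_nat n)"
      by simp
    ultimately have "of_int e * (2 * pi * of_int m / of_nat n) =
        of_int (m * int t) * pi + of_int \<sigma> * b"
      using n unfolding b_def by (simp add: field_simps)
    then show ?thesis unfolding q_def cis_power_int cis_mult by simp
  qed
  have "cis (of_int (m * int t) * pi) = (- 1) powi (m * int t)"
    by (metis cis_pi cis_power_int)
  moreover have "q powi (int t * (5 * int t + 1) div 2) = cis (of_int (m * int t) * pi) * cis (of_int 1 * b)"
    by (rule pow) simp
  moreover have "q powi (int t * (5 * int t - 1) div 2) = cis (of_int (m * int t) * pi) * cis (of_int (- 1) * b)"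
    by (rule pow) simp
  moreover have "cis b + cis (- b) = of_real (2 * cos b)"
    by (simp add: complex_eq_iff)
  ultimately have "(- 1) ^ t * (q powi (int t * (5 * int t + 1) div 2) +
      q powi (int t * (5 * int t - 1) div 2)) =
      (- 1) ^ t * (- 1) powi (m * int t) * of_real (2 * cos b)"
    by (simp add: distrib_left[symmetric])
  \<comment> \<open>The total exponent t (m + 1) is even for odd m; for even m coprimality makes n,
    and hence t, odd.\<close>
  also have "(- 1) ^ t * (- 1) powi (m * int t) = (of_real (if odd m then 1 else - 1) :: complex)"
  proof (cases "odd m")
    case False
    then have "\<not> 2 dvd int n" using cop coprime_common_divisor[of "int n" m 2] by auto
    then have "odd t" using n by simp
    then show ?thesis using False by (simp add: minus_one_power_int)
  qed (auto simp: minus_one_power_int)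
  also have "of_real (if odd m then 1 else - 1) * of_real (2 * cos b) =
      (of_real ((if odd m then 1 else - 1) * (2 * cos b)) :: complex)"
    by (simp only: of_real_mult)
  also have "(if odd m then 1 else - 1) * (2 * cos b) =
      1 / 2 * (1 + sqrt 5 * of_int (Legendre m 5))"
  proof -
    have "5 dvd int n" using n by simp
    then have "\<not> 5 dvd m" using cop coprime_common_divisor[of "int n" m 5] by auto
    then show ?thesis unfolding b_def by (rule cos_mult_pi_5)
  qed
  finally show ?thesis .
qed

lemma cis_primitive_root:
  fixes m :: int
  assumes "coprime (int n) m" "0 < j" "j < n"
  shows "cis (2 * pi * of_int m / of_nat n) ^ j \<noteq> 1"
proof
  assume "cis (2 * pi * of_int m / of_nat n) ^ j = 1"
  then have "cos (of_nat j * (2 * pi * of_int m / of_nat n)) = 1"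
    by (simp add: DeMoivre complex_eq_iff)
  then obtain k where "of_nat j * (2 * pi * of_int m / of_nat n) = of_int k * 2 * pi"
    using cos_one_2pi_int by blast
  then have "of_nat j * of_int m = of_int k * (of_nat n :: real)"
    using assms by (simp add: field_simps)
  then have "of_int (int j * m) = (of_int (k * int n) :: real)" by simp
  then have "int j * m = k * int n" by (simp only: of_int_eq_iff)
  then have "int n dvd int j"
    using assms(1) by (metis coprime_dvd_mult_left_iff dvd_triv_right)
  then show False using assms by (simp add: nat_dvd_not_less)
qed

text \<open>At \<open>w\<close>, the inverse of \<open>q\<close>, E(n+1) = E(n), so the recurrence
  with w^n = 1 gives E(n-1, w) = 0; what remains is E(n+1, q) - 2.\<close>

lemma qcatalan_sum_root_of_unity:
  fixes m :: int
  assumes n: "n \<ge> 1" "5 dvd n" and cop: "coprime (int n) m"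
    and q: "q = cis (2 * pi * of_int m / of_nat n)"
  shows "(\<Sum>k<n. (- 1) ^ k * q powi (- int (k choose 2)) * poly_at (qcatalan k) q) =
    of_real (1 / 2 * (sqrt 5 * of_int (Legendre m 5) - 3))"
proof -
  obtain t where t: "n = 5 * t" "t > 0" using n by (metis dvdE gr0I mult_0_right not_one_le_zero)
  have qn: "q ^ n = 1"
  proof -
    have "q ^ n = cis (2 * pi * of_int m)"
      using n unfolding q DeMoivre by simp
    then show ?thesis by simp
  qed
  have q0: "q \<noteq> 0" unfolding q by simp
  define w where "w = inverse q"
  have w: "q * w = 1" "w * q = 1" "w ^ n = 1"
    using q0 qn unfolding w_def by (simp_all add: power_inverse)
  have d: "gauss_binomial q n r = 0" if "0 < r" "r < n" for r
    using gauss_binomial_root_of_unity[OF qn _ that] cis_primitive_root[OF cop] q by blast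
  have dw: "gauss_binomial w n r = 0" if "0 < r" "r < n" for r
    using gauss_binomial_inverse[OF w(2)] d that by simp
  have "schur_sum w (Suc n) = schur_sum w n"
    using schur_sum_root_of_unity[OF dw w(3) t] by simp
  moreover have "schur_sum w (Suc n) = schur_sum w n + w ^ n * schur_sum w (n - 1)"
    using schur_sum_rec[of w "n - 1"] n by simp
  ultimately have "schur_sum w (n - 1) = 0" using w by simp
  moreover have "schur_sum q (Suc n) = of_real (1 / 2 * (1 + sqrt 5 * of_int (Legendre m 5)))"
    using schur_sum_root_of_unity(2)[OF d qn t] schur_value_cis[OF t cop] q by simp
  moreover have "(\<Sum>k<n. (- 1) ^ k * w ^ (k choose 2) *
      (gauss_binomial q (2 * k) k - q * gauss_binomial q (2 * k) (Suc k))) =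
      schur_sum w (n - 1) + schur_sum q (Suc n) - 2"
    using dvd_catalan_sum[of n 0 q w] d w qn t by simp
  moreover have pw: "q powi (- int c) = w ^ c" for c
    by (simp add: w_def power_int_minus power_inverse)
  ultimately show ?thesis
    unfolding poly_at_qcatalan pw by (simp add: add_divide_distrib diff_divide_distrib)
qed

section \<open>Congruences between rational numbers\<close>

lemma rat_cong_of_int:
  assumes "[x = y] (mod int p)"
  shows "rat_cong p (of_int x) (of_int y)"
proof -
  obtain z where "x - y = int p * z"
    using assms by (auto simp: cong_iff_dvd_diff)
  then have "rat_of_int x - of_int y = of_nat p * of_int z"
    by (metis of_int_diff of_int_mult of_int_of_nat_eq)
  then show ?thesis unfolding rat_cong_def p_integral_def
    by (metis coprime_1_left quotient_of_rat_of_int snd_conv)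
qed

text \<open>If z / 2 = a / b in lowest terms, then z b = 2 a, so b divides 2.\<close>

lemma p_integral_half:
  assumes "odd p"
  shows "p_integral p (of_int z / 2)"
proof -
  have "snd (quotient_of (of_int z / 2)) dvd 2"
  proof -
    obtain a b where ab: "quotient_of (of_int z / 2) = (a, b)" by fastforce
    then have "b > 0" "coprime a b" "of_int z / 2 = (of_int a / of_int b :: rat)"
      using quotient_of_denom_pos quotient_of_coprime quotient_of_div by blast+
    then have "of_int (z * b) = (of_int (a * 2) :: rat)" by (simp add: field_simps)
    then have "z * b = a * 2" by (simp only: of_int_eq_iff)
    then have "b dvd 2"
      using \<open>coprime a b\<close> by (metis coprime_commute coprime_dvd_mult_right_iff dvd_triv_right)
    then show ?thesis using ab by simp
  qed
  moreover have "coprime 2 (int p)" using assms by simp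
  ultimately show ?thesis
    unfolding p_integral_def by (rule coprime_divisors[OF _ dvd_refl])
qed

text \<open>For p = 5, where the Legendre symbol is 0: the numbers -4 and -3/2 differ by
  -5/2.\<close>

lemma rat_cong_minus_three_halves:
  assumes "[x = - 4] (mod 5)"
  shows "rat_cong 5 (of_int x) (- 3 / 2)"
proof -
  obtain y where "x + 4 = 5 * y"
    using assms by (auto simp: cong_iff_dvd_diff)
  then have "x = 5 * y - 4" by simp
  then have "rat_of_int x - (- 3 / 2) = of_nat 5 * (of_int (2 * y - 1) / 2)"
    by (simp add: field_simps)
  moreover have "p_integral 5 (of_int (2 * y - 1) / 2)" "p_integral 5 (- 3 / 2)"
    using p_integral_half[of 5 "2 * y - 1"] p_integral_half[of 5 "- 3"] by simp_all
  moreover have "p_integral 5 (of_int x)" by (simp add: p_integral_def)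
  ultimately show ?thesis unfolding rat_cong_def by blast
qed

theorem corollary6p4:
  shows
    "(\<forall>(n::nat) (m::int) (q::complex).
        n \<ge> 1 \<longrightarrow> coprime (int n) m \<longrightarrow>
        q = exp (2 * of_real pi * of_int m * \<i> / of_nat n) \<longrightarrow> 5 dvd n \<longrightarrow>
        (\<Sum>k=0..n-1. (-1) ^ k * q powi (- int (k choose 2)) * poly_at (qcatalan k) q)
          = 1 / 2 * (of_real (sqrt 5) * of_int (Legendre m 5) - 3))
     \<and>
     (\<forall>(a::nat) (p::nat). a > 0 \<longrightarrow> prime p \<longrightarrow>
        rat_cong p
          (\<Sum>k=0..p^a-1. (-1) ^ k * of_nat (catalan k))
          (1 / 2 * (5 * of_int (Legendre (int p ^ a) 5) - 3)))"
proof (intro conjI allI impI)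
  fix n :: nat and m :: int and q :: complex
  assume n: "n \<ge> 1" "coprime (int n) m" "5 dvd n"
    and q: "q = exp (2 * of_real pi * of_int m * \<i> / of_nat n)"
  have "q = cis (2 * pi * of_int m / of_nat n)"
    unfolding q cis_conv_exp by (simp add: mult_ac)
  moreover have "{0..n - 1} = {..<n}" using n by auto
  ultimately show "(\<Sum>k=0..n-1. (-1) ^ k * q powi (- int (k choose 2)) * poly_at (qcatalan k) q)
      = 1 / 2 * (of_real (sqrt 5) * of_int (Legendre m 5) - 3)"
    using qcatalan_sum_root_of_unity[of n m q] n by simp
next
  fix a p :: nat
  assume a: "a > 0" and p: "prime p"
  define S where "S = (\<Sum>k<p ^ a. (- 1) ^ k * int (catalan k))"
  have "{0..p ^ a - 1} = {..<p ^ a}"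
    using zero_less_power[OF prime_gt_0_nat[OF p], of a] by (cases "p ^ a") auto
  then have S: "(\<Sum>k=0..p^a-1. (-1) ^ k * of_nat (catalan k)) = rat_of_int S"
    by (simp add: S_def)
  have cong: "[S = (if p ^ a mod 5 = 1 \<or> p ^ a mod 5 = 4 then 1 else - 4)] (mod int p)"
    unfolding S_def by (rule catalan_sum_cong[OF p a])
  have pa: "int p ^ a mod 5 = int (p ^ a mod 5)" by (simp add: zmod_int)
  show "rat_cong p (\<Sum>k=0..p^a-1. (-1) ^ k * of_nat (catalan k))
      (1 / 2 * (5 * of_int (Legendre (int p ^ a) 5) - 3))"
  proof (cases "p ^ a mod 5 = 0")
    case True
    have "prime (5::nat)" by simp
    with True p have "p = 5"
      by (metis dvd_eq_mod_eq_0 prime_dvd_power primes_dvd_imp_eq)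
    then show ?thesis
      unfolding S using True cong pa rat_cong_minus_three_halves[of S] by (simp add: Legendre_5)
  next
    case False
    \<comment> \<open>The symbol is 1 or -1, and (5 - 3)/2 = 1, (-5 - 3)/2 = -4.\<close>
    then have "1 / 2 * (5 * of_int (Legendre (int p ^ a) 5) - 3) =
        rat_of_int (if p ^ a mod 5 = 1 \<or> p ^ a mod 5 = 4 then 1 else - 4)"
      unfolding Legendre_5 pa by auto
    then show ?thesis unfolding S using rat_cong_of_int[OF cong] by (simp only:)
  qed
qed

end
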